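(* Let $(\Omega,\mathscr{F},\mathbb{P})$ be a probability space, let $X:\Omega\to\mathbb{R}$ be a random variable, and let $\mu_X:=\mathbb{P}\circ X^{-1}$ be its distribution. Then the operator $$T_X: L^2(\mathbb{R},\mu_X)\to L^2(\Omega,\mathbb{P}),\qquad T_X(\varphi)=\varphi\circ X,$$ is isometric, and its adjoint $T_X^*:L^2(\Omega,\mathbb{P})\to L^2(\mathbb{R},\mu_X)$ is coisometric. The adjoint is given by the $X$-conditional expectation $$T_X^*(F)(x)=\mathbb{E}_{X=x}(F\mid\mathscr{F}_X),\qquad F\in L^2(\Omega,\mathbb{P}).$$
   Context: A random variable $X:\Omega\to\mathbb{R}$ is a function measurable with respect to $\mathscr{F}$ and the Borel $\sigma$-algebra $\mathscr{B}$ of $\mathbb{R}$. $\mathscr{F}_X:=X^{-1}(\mathscr{B})\subset\mathscr{F}$ is the pullback $\sigma$-algebra, and $\mathbb{E}(\cdot\mid\mathscr{F}_X)$ is the conditional expectation. The notation $\mathbb{E}_{X=x}(F\mid\mathscr{F}_X)$ denotes the function $\varphi(x)$ on $\mathbb{R}$ (determined $\mu_X$-almost everywhere) satisfying $\mathbb{E}(F\mid\mathscr{F}_X)=\varphi\circ X$. An operator is coisometric if its adjoint is isometric. *)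

theory Defs
  imports "HOL-Probability.Probability"
begin

text \<open>
  The scalar field of the Hilbert spaces is a type \<open>'k\<close> of sort
  \<open>{real_normed_field, euclidean_space}\<close>. Up to isomorphism this means the reals or the
  complex numbers, and both types are instances of the sort. Conjugation negates the part
  orthogonal to 1.
\<close>

definition sconj :: "'k \<Rightarrow> 'k::{real_normed_field, euclidean_space}" where
  "sconj z = 2 * of_real (z \<bullet> 1) - z"

lemma sconj_real: "sconj (x::real) = x"
  by (simp add: sconj_def)

lemma sconj_complex: "sconj z = cnj z"
  by (simp add: sconj_def complex_eq_iff inner_complex_def)

definition L2_fun :: "'a measure \<Rightarrow> ('a \<Rightarrow> 'k::{real_normed_field, euclidean_space}) set" where
  "L2_fun M = {f \<in> borel_measurable M. integrable M (\<lambda>x. (norm (f x))\<^sup>2)}"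

definition l2_rel :: "'a measure \<Rightarrow> (('a \<Rightarrow> 'k::{real_normed_field, euclidean_space}) \<times> ('a \<Rightarrow> 'k)) set" where
  "l2_rel M = {(f, g). f \<in> L2_fun M \<and> g \<in> L2_fun M \<and> (AE x in M. f x = g x)}"

definition L2 :: "'a measure \<Rightarrow> ('a \<Rightarrow> 'k::{real_normed_field, euclidean_space}) set set" where
  "L2 M = L2_fun M // l2_rel M"

definition l2_class :: "'a measure \<Rightarrow> ('a \<Rightarrow> 'k) \<Rightarrow> ('a \<Rightarrow> 'k::{real_normed_field, euclidean_space}) set" where
  "l2_class M f = l2_rel M `` {f}"

definition l2_rep :: "('a \<Rightarrow> 'k) set \<Rightarrow> 'a \<Rightarrow> 'k" where
  "l2_rep a = (SOME f. f \<in> a)"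

definition l2_add :: "'a measure \<Rightarrow> ('a \<Rightarrow> 'k) set \<Rightarrow> ('a \<Rightarrow> 'k) set \<Rightarrow> ('a \<Rightarrow> 'k::{real_normed_field, euclidean_space}) set" where
  "l2_add M a b = l2_class M (\<lambda>x. l2_rep a x + l2_rep b x)"

definition l2_scale :: "'a measure \<Rightarrow> 'k \<Rightarrow> ('a \<Rightarrow> 'k) set \<Rightarrow> ('a \<Rightarrow> 'k::{real_normed_field, euclidean_space}) set" where
  "l2_scale M c a = l2_class M (\<lambda>x. c * l2_rep a x)"

definition l2_inner :: "'a measure \<Rightarrow> ('a \<Rightarrow> 'k) set \<Rightarrow> ('a \<Rightarrow> 'k) set \<Rightarrow> 'k::{real_normed_field, euclidean_space}" where
  "l2_inner M a b = (\<integral>x. l2_rep a x * sconj (l2_rep b x) \<partial>M)"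

definition l2_norm :: "'a measure \<Rightarrow> ('a \<Rightarrow> 'k::{real_normed_field, euclidean_space}) set \<Rightarrow> real" where
  "l2_norm M a = sqrt (\<integral>x. (norm (l2_rep a x))\<^sup>2 \<partial>M)"

definition l2_operator ::
    "'a measure \<Rightarrow> 'b measure \<Rightarrow> (('a \<Rightarrow> 'k) set \<Rightarrow> ('b \<Rightarrow> 'k::{real_normed_field, euclidean_space}) set) \<Rightarrow> bool" where
  "l2_operator M N T \<longleftrightarrow>
     (\<forall>a\<in>L2 M. T a \<in> L2 N) \<and>
     (\<forall>a\<in>L2 M. \<forall>b\<in>L2 M. T (l2_add M a b) = l2_add N (T a) (T b)) \<and>
     (\<forall>c. \<forall>a\<in>L2 M. T (l2_scale M c a) = l2_scale N c (T a)) \<and>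
     (\<exists>C. \<forall>a\<in>L2 M. l2_norm N (T a) \<le> C * l2_norm M a)"

definition l2_isometric ::
    "'a measure \<Rightarrow> 'b measure \<Rightarrow> (('a \<Rightarrow> 'k) set \<Rightarrow> ('b \<Rightarrow> 'k::{real_normed_field, euclidean_space}) set) \<Rightarrow> bool" where
  "l2_isometric M N T \<longleftrightarrow>
     l2_operator M N T \<and> (\<forall>a\<in>L2 M. l2_norm N (T a) = l2_norm M a)"

definition is_l2_adjoint ::
    "'a measure \<Rightarrow> 'b measure \<Rightarrow> (('a \<Rightarrow> 'k) set \<Rightarrow> ('b \<Rightarrow> 'k) set) \<Rightarrow>
      (('b \<Rightarrow> 'k) set \<Rightarrow> ('a \<Rightarrow> 'k::{real_normed_field, euclidean_space}) set) \<Rightarrow> bool" where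
  "is_l2_adjoint M N T S \<longleftrightarrow>
     l2_operator N M S \<and>
     (\<forall>a\<in>L2 M. \<forall>b\<in>L2 N. l2_inner N (T a) b = l2_inner M a (S b))"

text \<open>Extensionality makes the HOL function unique: it is fixed to \<open>undefined\<close> off \<open>L2 N\<close>.\<close>

definition l2_adjoint ::
    "'a measure \<Rightarrow> 'b measure \<Rightarrow> (('a \<Rightarrow> 'k) set \<Rightarrow> ('b \<Rightarrow> 'k) set) \<Rightarrow>
      ('b \<Rightarrow> 'k) set \<Rightarrow> ('a \<Rightarrow> 'k::{real_normed_field, euclidean_space}) set" where
  "l2_adjoint M N T = (THE S. S \<in> extensional (L2 N) \<and> is_l2_adjoint M N T S)"

definition l2_coisometric ::
    "'a measure \<Rightarrow> 'b measure \<Rightarrow> (('a \<Rightarrow> 'k) set \<Rightarrow> ('b \<Rightarrow> 'k::{real_normed_field, euclidean_space}) set) \<Rightarrow> bool" where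
  "l2_coisometric M N T \<longleftrightarrow> l2_operator M N T \<and> l2_isometric N M (l2_adjoint M N T)"

definition comp_op ::
    "'a measure \<Rightarrow> ('a \<Rightarrow> real) \<Rightarrow> (real \<Rightarrow> 'k) set \<Rightarrow> ('a \<Rightarrow> 'k::{real_normed_field, euclidean_space}) set" where
  "comp_op M X = (\<lambda>a\<in>L2 (distr M borel X). l2_class M (l2_rep a \<circ> X))"

definition pullback_algebra :: "'a measure \<Rightarrow> ('a \<Rightarrow> real) \<Rightarrow> 'a measure" where
  "pullback_algebra M X = vimage_algebra (space M) X borel"

text \<open>The library's conditional expectation is real-valued; it is taken here in each real coordinate.\<close>

definition cond_exp :: "'a measure \<Rightarrow> 'a measure \<Rightarrow> ('a \<Rightarrow> 'k) \<Rightarrow> 'a \<Rightarrow> 'k::euclidean_space" where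
  "cond_exp M G F = (\<lambda>x. \<Sum>b\<in>Basis. real_cond_exp M G (\<lambda>y. F y \<bullet> b) x *\<^sub>R b)"

lemma cond_exp_real: "cond_exp M G F = real_cond_exp M G F"
  by (simp add: cond_exp_def)

lemma cond_exp_complex:
  "cond_exp M G F =
     (\<lambda>x. Complex (real_cond_exp M G (\<lambda>y. Re (F y)) x) (real_cond_exp M G (\<lambda>y. Im (F y)) x))"
  by (simp add: cond_exp_def Basis_complex_def inner_complex_def complex_eq_iff fun_eq_iff)

text \<open>\<open>\<phi>\<close> is a version of the function \<open>x \<mapsto> E\<^sub>X\<^sub>=\<^sub>x(F | F\<^sub>X)\<close>, which is only determined
  almost everywhere with respect to the distribution of \<open>X\<close>.\<close>

definition cond_exp_at ::
    "'a measure \<Rightarrow> ('a \<Rightarrow> real) \<Rightarrow> ('a \<Rightarrow> 'k::euclidean_space) \<Rightarrow> (real \<Rightarrow> 'k) \<Rightarrow> bool" where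
  "cond_exp_at M X F \<phi> \<longleftrightarrow>
     \<phi> \<in> borel_measurable borel \<and>
     (AE \<omega> in M. cond_exp M (pullback_algebra M X) F \<omega> = (\<phi> \<circ> X) \<omega>)"

end

theory Submission
  imports Defs
begin

text \<open>
  The change of variables formula makes \<open>\<phi> \<mapsto> \<phi> \<circ> X\<close> isometric. By the Doob-Dynkin factorization,
  \<open>E(F | F\<^sub>X) = \<phi> \<circ> X\<close> for some Borel function \<open>\<phi>\<close>, which is square integrable by Jensen's
  inequality. Since \<open>\<psi> \<circ> X\<close> is measurable with respect to the pullback algebra, the pull-out
  property gives \<open>\<langle>\<psi> \<circ> X, F\<rangle> = \<langle>\<psi> \<circ> X, \<phi> \<circ> X\<rangle> = \<langle>\<psi>, \<phi>\<rangle>\<close>, so \<open>F \<mapsto> \<phi>\<close> satisfies the adjoint relation.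
  Linearity, boundedness and uniqueness of the adjoint follow from this relation alone because the
  inner product is nondegenerate. For a general scalar field \<open>'k\<close> all that is needed is that the
  adjoint of multiplication by \<open>x\<close> is multiplication by \<open>sconj x\<close>, which comes from
  polarizing \<open>\<parallel>x y\<parallel> = \<parallel>x\<parallel> \<parallel>y\<parallel>\<close>.
\<close>

section \<open>Conjugation in the scalar field\<close>

lemma inner_mult_mult_left:
  fixes x y z :: "'k::{real_normed_field, euclidean_space}"
  shows "(x * y) \<bullet> (x * z) = (norm x)\<^sup>2 * (y \<bullet> z)"
proof -
  have "(norm (x * y + x * z))\<^sup>2 = (norm x)\<^sup>2 * (norm (y + z))\<^sup>2"
    by (simp add: norm_mult power_mult_distrib flip: distrib_left)
  then show ?thesis
    unfolding dot_norm[of "x * y"] dot_norm[of y]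
    by (simp add: norm_mult power_mult_distrib right_diff_distrib)
qed

text \<open>Expanding \<open>inner_mult_mult_left\<close> for x + 1 in place of x and cancelling the
  same identity for x leaves the cross terms: (x y) \<bullet> z + y \<bullet> (x z) = 2 (x \<bullet>
  1) (y \<bullet> z). Solving for the first term yields exactly multiplication by
  \<open>sconj x\<close> on the other side.\<close>

lemma inner_mult_sconj:
  fixes x y z :: "'k::{real_normed_field, euclidean_space}"
  shows "(x * y) \<bullet> z = y \<bullet> (sconj x * z)"
proof -
  have "((x + 1) * y) \<bullet> ((x + 1) * z) = (norm (x + 1))\<^sup>2 * (y \<bullet> z)"
    by (rule inner_mult_mult_left)
  moreover have "((x + 1) * y) \<bullet> ((x + 1) * z) = (x * y) \<bullet> (x * z) + (x * y) \<bullet> z + y \<bullet> (x * z) + y \<bullet> z"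
    by (simp add: distrib_right inner_add_left inner_add_right)
  moreover have "(norm (x + 1))\<^sup>2 = (norm x)\<^sup>2 + 2 * (x \<bullet> 1) + 1"
    using dot_norm[of x 1] by simp
  moreover have "(2 * of_real (x \<bullet> 1)) * z = (2 * (x \<bullet> 1)) *\<^sub>R z" by (simp add: scaleR_conv_of_real)
  then have "y \<bullet> (sconj x * z) = 2 * (x \<bullet> 1) * (y \<bullet> z) - y \<bullet> (x * z)"
    by (simp add: sconj_def left_diff_distrib inner_diff_right)
  ultimately show ?thesis
    using inner_mult_mult_left[of x y z]
    by (simp add: distrib_right)
qed

text \<open>The inner product (x y w) \<bullet> 1 is moved onto w in two ways, shifting x y at once
  or shifting x and then y. Comparing the results for all w gives the claim.\<close>

lemma sconj_mult: "sconj (x * y) = sconj x * sconj y"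
proof -
  have "w \<bullet> sconj (x * y) = w \<bullet> (sconj x * sconj y)" for w
    using inner_mult_sconj[of "x * y" w 1] inner_mult_sconj[of x "y * w" 1] inner_mult_sconj[of y w "sconj x"]
    by (simp add: mult_ac)
  then show ?thesis
    using vector_eq_ldot by blast
qed

lemma linear_sconj: "linear sconj"
  by (rule linearI)
    (simp_all add: sconj_def inner_add_left algebra_simps, simp add: scaleR_conv_of_real)

lemma bounded_linear_sconj: "bounded_linear sconj"
  using linear_sconj by (simp add: linear_conv_bounded_linear)

lemma sconj_sconj: "sconj (sconj x) = x"
proof -
  have "sconj x \<bullet> 1 = x \<bullet> 1"
    using inner_mult_sconj[of x 1 1] by (simp add: inner_commute)
  then have "sconj (sconj x) = 2 * of_real (x \<bullet> 1) - sconj x"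
    by (simp add: sconj_def[of "sconj x"])
  then show ?thesis
    by (simp add: sconj_def[of x])
qed

lemma mult_sconj_self: "x * sconj x = of_real ((norm x)\<^sup>2)"
proof -
  have "w \<bullet> (x * sconj x) = w \<bullet> of_real ((norm x)\<^sup>2)" for w
    using inner_mult_sconj[of x w x] inner_mult_mult_left[of x w 1]
    by (simp add: mult_ac of_real_def)
  then show ?thesis
    using vector_eq_ldot by blast
qed

lemma norm_sconj: "norm (sconj x) = norm x"
proof -
  \<comment> \<open>This takes norms in \<open>mult_sconj_self\<close>; the factor
    \<open>norm x\<close> cancels unless x is 0.\<close>
  have "norm x * norm (sconj x) = norm x * norm x"
    by (metis abs_norm_cancel abs_power2 mult_sconj_self norm_mult norm_of_real power2_eq_square)
  then show ?thesis
    by (cases "x = 0") (auto simp: linear_0[OF linear_sconj])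
qed

lemma borel_measurable_sconj [measurable]: "sconj \<in> borel_measurable borel"
  by (intro borel_measurable_continuous_onI bounded_linear.continuous_on[OF bounded_linear_sconj]
      continuous_on_id)

section \<open>Square-integrable functions\<close>

lemma L2_funI:
  "f \<in> borel_measurable M \<Longrightarrow> integrable M (\<lambda>x. (norm (f x))\<^sup>2) \<Longrightarrow> f \<in> L2_fun M"
  by (simp add: L2_fun_def)

lemma
  assumes "f \<in> L2_fun M"
  shows L2_fun_measurable: "f \<in> borel_measurable M"
    and L2_fun_integrable: "integrable M (\<lambda>x. (norm (f x))\<^sup>2)"
  using assms by (simp_all add: L2_fun_def)

lemma L2_fun_add:
  assumes "f \<in> L2_fun M" "g \<in> L2_fun M"
  shows "(\<lambda>x. f x + g x) \<in> L2_fun M"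
proof -
  note [measurable] = assms[THEN L2_fun_measurable]
  have "(norm (f x + g x))\<^sup>2 \<le> 2 * (norm (f x))\<^sup>2 + 2 * (norm (g x))\<^sup>2" for x
  proof -
    have "(norm (f x + g x))\<^sup>2 \<le> (norm (f x) + norm (g x))\<^sup>2"
      by (intro power_mono norm_triangle_ineq) simp
    then show ?thesis
      using sum_squares_bound[of "norm (f x)" "norm (g x)"] by (simp add: power2_sum)
  qed
  then have "integrable M (\<lambda>x. (norm (f x + g x))\<^sup>2)"
    using assms[THEN L2_fun_integrable]
    by (auto intro: Bochner_Integration.integrable_bound[of M "\<lambda>x. 2 * (norm (f x))\<^sup>2 + 2 * (norm (g x))\<^sup>2"])
  then show ?thesis
    by (intro L2_funI) measurable
qed

lemma L2_fun_mult_left: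
  assumes "f \<in> L2_fun M"
  shows "(\<lambda>x. c * f x) \<in> L2_fun M"
  using assms by (auto simp: L2_fun_def norm_mult power_mult_distrib)

lemma L2_fun_diff:
  assumes "f \<in> L2_fun M" "g \<in> L2_fun M"
  shows "(\<lambda>x. f x - g x) \<in> L2_fun M"
  using L2_fun_add[OF assms(1) L2_fun_mult_left[OF assms(2), of "-1"]] by simp

text \<open>A general \<open>h\<close> covers two later uses: the integrand of the inner product,
  and products of real coordinates.\<close>

lemma L2_fun_integrable_prod:
  fixes h :: "'k::{real_normed_field, euclidean_space} \<Rightarrow> 'l::{real_normed_field, euclidean_space} \<Rightarrow>
    'c::{banach, second_countable_topology}"
  assumes f: "f \<in> L2_fun M" and g: "g \<in> L2_fun M"
    and [measurable]: "(\<lambda>x. h (f x) (g x)) \<in> borel_measurable M"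
    and h: "\<And>a b. norm (h a b) \<le> norm a * norm b"
  shows "integrable M (\<lambda>x. h (f x) (g x))"
proof (rule Bochner_Integration.integrable_bound)
  show "integrable M (\<lambda>x. (norm (f x))\<^sup>2 + (norm (g x))\<^sup>2)"
    using f g by (simp add: L2_fun_integrable)
  have "norm (h a b) \<le> (norm a)\<^sup>2 + (norm b)\<^sup>2" for a b
  proof -
    have "norm a * norm b \<ge> 0" by simp
    then show ?thesis
      using h[of a b] sum_squares_bound[of "norm a" "norm b"] by linarith
  qed
  then show "AE x in M. norm (h (f x) (g x)) \<le> norm ((norm (f x))\<^sup>2 + (norm (g x))\<^sup>2)"
    by simp
qed measurable

lemma L2_fun_integrable_mult_sconj:
  assumes "f \<in> L2_fun M" "g \<in> L2_fun M"
  shows "integrable M (\<lambda>x. f x * sconj (g x))"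
  using assms(1,2)
proof (rule L2_fun_integrable_prod)
  note [measurable] = assms[THEN L2_fun_measurable]
  show "(\<lambda>x. f x * sconj (g x)) \<in> borel_measurable M" by measurable
qed (simp add: norm_mult norm_sconj)

section \<open>The quotient by almost everywhere equality\<close>

lemma equiv_l2_rel: "equiv (L2_fun M) (l2_rel M)"
proof (rule equivI)
  show "refl_on (L2_fun M) (l2_rel M)"
    by (auto simp: l2_rel_def refl_on_def)
  show "sym (l2_rel M)"
    by (rule symI) (simp add: l2_rel_def eq_commute)
  show "trans (l2_rel M)"
  proof (rule transI)
    fix f g h
    assume fg: "(f, g) \<in> l2_rel M" and gh: "(g, h) \<in> l2_rel M"
    then have "AE x in M. f x = g x" "AE x in M. g x = h x"
      by (simp_all add: l2_rel_def)
    then have "AE x in M. f x = h x"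
      by eventually_elim simp
    with fg gh show "(f, h) \<in> l2_rel M"
      by (simp add: l2_rel_def)
  qed
qed (simp add: l2_rel_def subset_iff)

lemma l2_class_in_L2: "f \<in> L2_fun M \<Longrightarrow> l2_class M f \<in> L2 M"
  by (simp add: L2_def l2_class_def quotientI)

lemma L2_cases:
  assumes "a \<in> L2 M"
  obtains f where "f \<in> L2_fun M" "a = l2_class M f"
  using assms by (auto simp: L2_def l2_class_def elim!: quotientE)

lemma l2_class_eq_iff:
  assumes "f \<in> L2_fun M" "g \<in> L2_fun M"
  shows "l2_class M f = l2_class M g \<longleftrightarrow> (AE x in M. f x = g x)"
  using eq_equiv_class_iff[OF equiv_l2_rel assms] assms by (simp add: l2_class_def l2_rel_def)

text \<open>The arbitrary choice made by \<open>l2_rep\<close> changes a function only on a null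
  set. Hence the operations defined through \<open>l2_rep\<close> can be computed from any member of
  the class.\<close>

lemma
  assumes "f \<in> L2_fun M"
  shows l2_rep_class_in_L2_fun: "l2_rep (l2_class M f) \<in> L2_fun M"
    and AE_l2_rep_class: "AE x in M. l2_rep (l2_class M f) x = f x"
proof -
  have "f \<in> l2_class M f"
    using equiv_class_self[OF equiv_l2_rel assms] by (simp add: l2_class_def)
  then have "l2_rep (l2_class M f) \<in> l2_class M f"
    unfolding l2_rep_def by (rule someI[where P = "\<lambda>g. g \<in> l2_class M f"])
  then have "(f, l2_rep (l2_class M f)) \<in> l2_rel M"
    by (simp add: l2_class_def)
  then show "l2_rep (l2_class M f) \<in> L2_fun M" "AE x in M. l2_rep (l2_class M f) x = f x"
    by (simp_all add: l2_rel_def eq_commute)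
qed

lemma
  assumes "a \<in> L2 M"
  shows l2_rep_in_L2_fun: "l2_rep a \<in> L2_fun M"
    and l2_class_rep: "l2_class M (l2_rep a) = a"
proof -
  obtain f where f: "f \<in> L2_fun M" "a = l2_class M f"
    using assms by (rule L2_cases)
  show "l2_rep a \<in> L2_fun M"
    using f by (simp add: l2_rep_class_in_L2_fun)
  then show "l2_class M (l2_rep a) = a"
    using AE_l2_rep_class[of f M] f by (simp add: l2_class_eq_iff)
qed

lemma l2_add_class:
  assumes "f \<in> L2_fun M" "g \<in> L2_fun M"
  shows "l2_add M (l2_class M f) (l2_class M g) = l2_class M (\<lambda>x. f x + g x)"
  unfolding l2_add_def using AE_l2_rep_class[OF assms(1)] AE_l2_rep_class[OF assms(2)]
  by (subst l2_class_eq_iff) (auto intro!: L2_fun_add assms l2_rep_class_in_L2_fun)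

lemma l2_scale_class:
  assumes "f \<in> L2_fun M"
  shows "l2_scale M c (l2_class M f) = l2_class M (\<lambda>x. c * f x)"
  unfolding l2_scale_def using AE_l2_rep_class[OF assms(1)]
  by (subst l2_class_eq_iff) (auto intro!: L2_fun_mult_left assms l2_rep_class_in_L2_fun)

lemma l2_inner_class:
  assumes "f \<in> L2_fun M" "g \<in> L2_fun M"
  shows "l2_inner M (l2_class M f) (l2_class M g) = (\<integral>x. f x * sconj (g x) \<partial>M)"
proof -
  note [measurable] = assms[THEN L2_fun_measurable]
    assms[THEN l2_rep_class_in_L2_fun, THEN L2_fun_measurable]
  show ?thesis
    unfolding l2_inner_def using AE_l2_rep_class[OF assms(1)] AE_l2_rep_class[OF assms(2)]
    by (intro integral_cong_AE) auto
qed

lemma l2_norm_class: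
  assumes "f \<in> L2_fun M"
  shows "l2_norm M (l2_class M f) = sqrt (\<integral>x. (norm (f x))\<^sup>2 \<partial>M)"
proof -
  note [measurable] = assms[THEN L2_fun_measurable]
    assms[THEN l2_rep_class_in_L2_fun, THEN L2_fun_measurable]
  have "(\<integral>x. (norm (l2_rep (l2_class M f) x))\<^sup>2 \<partial>M) = (\<integral>x. (norm (f x))\<^sup>2 \<partial>M)"
    using AE_l2_rep_class[OF assms] by (intro integral_cong_AE) auto
  then show ?thesis
    by (simp add: l2_norm_def)
qed

lemma l2_add_in_L2: "a \<in> L2 M \<Longrightarrow> b \<in> L2 M \<Longrightarrow> l2_add M a b \<in> L2 M"
  unfolding l2_add_def by (intro l2_class_in_L2 L2_fun_add l2_rep_in_L2_fun)

lemma l2_scale_in_L2: "a \<in> L2 M \<Longrightarrow> l2_scale M c a \<in> L2 M"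
  unfolding l2_scale_def by (intro l2_class_in_L2 L2_fun_mult_left l2_rep_in_L2_fun)

section \<open>The inner product on classes\<close>

lemma l2_inner_add_right:
  assumes "a \<in> L2 M" "b \<in> L2 M" "c \<in> L2 M"
  shows "l2_inner M a (l2_add M b c) = l2_inner M a b + l2_inner M a c"
  using assms
  by (elim L2_cases)
    (simp add: l2_add_class l2_inner_class L2_fun_add L2_fun_integrable_mult_sconj
      linear_add[OF linear_sconj] distrib_left)

lemma l2_inner_scale_right:
  assumes "a \<in> L2 M" "b \<in> L2 M"
  shows "l2_inner M a (l2_scale M c b) = sconj c * l2_inner M a b"
proof -
  obtain f g where f: "f \<in> L2_fun M" "a = l2_class M f" and g: "g \<in> L2_fun M" "b = l2_class M g"
    using assms by (meson L2_cases)
  have "l2_inner M a (l2_scale M c b) = (\<integral>x. sconj c * (f x * sconj (g x)) \<partial>M)"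
    using f g
    by (simp add: l2_scale_class l2_inner_class L2_fun_mult_left sconj_mult mult.left_commute)
  also have "\<dots> = sconj c * (\<integral>x. f x * sconj (g x) \<partial>M)"
    by simp
  also have "\<dots> = sconj c * l2_inner M a b"
    using f g by (simp add: l2_inner_class)
  finally show ?thesis .
qed

lemma l2_inner_commute:
  assumes "a \<in> L2 M" "b \<in> L2 M"
  shows "l2_inner M a b = sconj (l2_inner M b a)"
  using assms
  by (elim L2_cases)
    (simp add: l2_inner_class integral_bounded_linear[OF bounded_linear_sconj, symmetric]
      L2_fun_integrable_mult_sconj sconj_mult sconj_sconj mult.commute)

lemma l2_inner_self:
  assumes "a \<in> L2 M"
  shows "l2_inner M a a = of_real ((l2_norm M a)\<^sup>2)"
  using assms
  by (elim L2_cases)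
    (simp add: l2_inner_class l2_norm_class mult_sconj_self
      integral_bounded_linear[OF bounded_linear_of_real] L2_fun_integrable del: of_real_power)

text \<open>This weak form of the Cauchy-Schwarz inequality suffices to bound the adjoint of an isometry:
  it gives \<open>2 \<parallel>S b\<parallel>\<^sup>2 = 2 \<bar>\<langle>T (S b), b\<rangle>\<bar> \<le> \<parallel>S b\<parallel>\<^sup>2 + \<parallel>b\<parallel>\<^sup>2\<close>.\<close>

lemma norm_l2_inner_le:
  assumes "a \<in> L2 M" "b \<in> L2 M"
  shows "2 * norm (l2_inner M a b) \<le> (l2_norm M a)\<^sup>2 + (l2_norm M b)\<^sup>2"
proof -
  obtain f g where f: "f \<in> L2_fun M" "a = l2_class M f" and g: "g \<in> L2_fun M" "b = l2_class M g"
    using assms by (meson L2_cases)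
  have "norm (l2_inner M a b) \<le> (\<integral>x. norm (f x * sconj (g x)) \<partial>M)"
    using f g by (simp add: l2_inner_class)
  also have "\<dots> \<le> (\<integral>x. ((norm (f x))\<^sup>2 + (norm (g x))\<^sup>2) / 2 \<partial>M)"
  proof (rule integral_mono)
    show "norm (f x * sconj (g x)) \<le> ((norm (f x))\<^sup>2 + (norm (g x))\<^sup>2) / 2" for x
      using sum_squares_bound[of "norm (f x)" "norm (g x)"] by (simp add: norm_mult norm_sconj)
  qed (use f g in \<open>simp_all add: L2_fun_integrable L2_fun_integrable_mult_sconj\<close>)
  also have "\<dots> = ((l2_norm M a)\<^sup>2 + (l2_norm M b)\<^sup>2) / 2"
    using f g by (simp add: l2_norm_class L2_fun_integrable)
  finally show ?thesis by simp
qed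

text \<open>Nondegeneracy: this is how equalities between values of adjoints are proved
  below.\<close>

lemma l2_eqI:
  assumes u: "u \<in> L2 M" and v: "v \<in> L2 M"
    and eq: "\<And>a. a \<in> L2 M \<Longrightarrow> l2_inner M a u = l2_inner M a v"
  shows "u = v"
proof -
  obtain f g where f: "f \<in> L2_fun M" "u = l2_class M f" and g: "g \<in> L2_fun M" "v = l2_class M g"
    using u v by (meson L2_cases)
  \<comment> \<open>Testing against the difference itself turns the hypothesis into the vanishing of
    its squared norm.\<close>
  define h where "h = (\<lambda>x. f x - g x)"
  have h: "h \<in> L2_fun M"
    unfolding h_def using f g by (intro L2_fun_diff)
  have "of_real (\<integral>x. (norm (h x))\<^sup>2 \<partial>M) = (\<integral>x. h x * sconj (h x) \<partial>M)"
    using L2_fun_integrable[OF h]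
    by (simp add: mult_sconj_self integral_bounded_linear[OF bounded_linear_of_real] del: of_real_power)
  also have "\<dots> = (\<integral>x. h x * sconj (f x) - h x * sconj (g x) \<partial>M)"
    by (simp add: h_def linear_diff[OF linear_sconj] right_diff_distrib)
  also have "\<dots> = l2_inner M (l2_class M h) u - l2_inner M (l2_class M h) v"
    using f g h by (simp add: l2_inner_class L2_fun_integrable_mult_sconj)
  also have "\<dots> = 0"
    using eq[OF l2_class_in_L2[OF h]] by simp
  finally have "(\<integral>x. (norm (h x))\<^sup>2 \<partial>M) = 0"
    by (simp only: of_real_eq_0_iff)
  then have "AE x in M. h x = 0"
    using L2_fun_integrable[OF h] by (simp add: integral_nonneg_eq_0_iff_AE)
  then show ?thesis
    using f g by (simp add: h_def l2_class_eq_iff)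
qed

section \<open>Existence and uniqueness of adjoints\<close>

text \<open>Linearity of \<open>S\<close> follows by testing against every \<open>a\<close>: both
  sides reduce to inner products with \<open>T a\<close>, and a scalar leaves the second slot as the
  same conjugate on both sides.\<close>

lemma is_l2_adjointI:
  assumes T: "l2_isometric M N T"
    and S: "\<And>b. b \<in> L2 N \<Longrightarrow> S b \<in> L2 M"
    and adj: "\<And>a b. a \<in> L2 M \<Longrightarrow> b \<in> L2 N \<Longrightarrow> l2_inner N (T a) b = l2_inner M a (S b)"
  shows "is_l2_adjoint M N T S"
proof -
  have TL: "T a \<in> L2 N" and iso: "l2_norm N (T a) = l2_norm M a" if "a \<in> L2 M" for a
    using T that by (auto simp: l2_isometric_def l2_operator_def)
  have "S (l2_add N b c) = l2_add M (S b) (S c)" if "b \<in> L2 N" "c \<in> L2 N" for b c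
    by (rule l2_eqI[where M = M])
      (simp_all add: that S TL l2_add_in_L2 l2_inner_add_right flip: adj)
  moreover have "S (l2_scale N c b) = l2_scale M c (S b)" if "b \<in> L2 N" for b c
    by (rule l2_eqI[where M = M])
      (simp_all add: that S TL l2_scale_in_L2 l2_inner_scale_right flip: adj)
  moreover have "l2_norm M (S b) \<le> 1 * l2_norm N b" if b: "b \<in> L2 N" for b
  proof -
    have "2 * (l2_norm M (S b))\<^sup>2 = 2 * norm (l2_inner N (T (S b)) b)"
      using b S by (simp add: adj l2_inner_self norm_power)
    also have "\<dots> \<le> (l2_norm M (S b))\<^sup>2 + (l2_norm N b)\<^sup>2"
      using norm_l2_inner_le[OF TL[OF S[OF b]] b] iso[OF S[OF b]] by simp
    finally have "(l2_norm M (S b))\<^sup>2 \<le> (l2_norm N b)\<^sup>2" by simp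
    then show ?thesis
      by (simp add: abs_le_square_iff[symmetric] l2_norm_def)
  qed
  ultimately show ?thesis
    using S adj unfolding is_l2_adjoint_def l2_operator_def by blast
qed

text \<open>Two candidates agree on \<open>L2 N\<close> by nondegeneracy and off it by
  extensionality, so the description in \<open>l2_adjoint\<close> has a unique solution.\<close>

lemma l2_adjoint_eqI:
  fixes S :: "('b \<Rightarrow> 'k) set \<Rightarrow> ('a \<Rightarrow> 'k::{real_normed_field, euclidean_space}) set"
  assumes S: "S \<in> extensional (L2 N)" "is_l2_adjoint M N T S"
  shows "l2_adjoint M N T = S"
  unfolding l2_adjoint_def
proof (rule the_equality)
  fix R assume R: "R \<in> extensional (L2 N) \<and> is_l2_adjoint M N T R"
  show "R = S"
  proof (rule extensionalityI)
    fix b :: "('b \<Rightarrow> 'k) set" assume b: "b \<in> L2 N"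
    show "R b = S b"
    proof (rule l2_eqI)
      show "R b \<in> L2 M" "S b \<in> L2 M"
        using R S b by (auto simp: is_l2_adjoint_def l2_operator_def)
      show "l2_inner M a (R b) = l2_inner M a (S b)" if "a \<in> L2 M" for a
        using R S b that by (metis is_l2_adjoint_def)
    qed
  qed (use R S in auto)
qed (use S in simp)

section \<open>Doob-Dynkin factorization\<close>

text \<open>A real function is recovered from its upper level sets at rational heights, and each of
  these is the preimage under \<open>X\<close> of a measurable set.\<close>

lemma real_measurable_vimage_algebra_factor:
  fixes g :: "'a \<Rightarrow> real"
  assumes g: "g \<in> borel_measurable (vimage_algebra \<Omega> X N)" and X: "X \<in> \<Omega> \<rightarrow> space N"
  obtains \<phi> where "\<phi> \<in> borel_measurable N" "\<And>\<omega>. \<omega> \<in> \<Omega> \<Longrightarrow> g \<omega> = \<phi> (X \<omega>)"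
proof -
  have "\<exists>B\<in>sets N. g -` {real_of_rat q<..} \<inter> \<Omega> = X -` B \<inter> \<Omega>" for q
    using measurable_sets[OF g, of "{real_of_rat q<..}"] X by (auto simp: sets_vimage_algebra2)
  then obtain B where B [measurable]: "\<And>q. B q \<in> sets N"
    and eq: "\<And>q. g -` {real_of_rat q<..} \<inter> \<Omega> = X -` B q \<inter> \<Omega>"
    by metis
  \<comment> \<open>The supremum of all q with x in \<open>B q\<close>. Off the image of
    \<open>X\<close> the sets \<open>B q\<close> are uncontrolled and the value may be infinite,
    hence the extended reals.\<close>
  define \<phi> where "\<phi> x = (SUP q. if x \<in> B q then ereal (real_of_rat q) else -\<infinity>)" for x
  have "\<phi> (X \<omega>) = ereal (g \<omega>)" if \<omega>: "\<omega> \<in> \<Omega>" for \<omega>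
  proof (rule antisym)
    have B_iff: "X \<omega> \<in> B q \<longleftrightarrow> real_of_rat q < g \<omega>" for q
      using eq[of q] \<omega> by auto
    show "\<phi> (X \<omega>) \<le> ereal (g \<omega>)"
      unfolding \<phi>_def by (rule SUP_least) (simp add: B_iff)
    show "ereal (g \<omega>) \<le> \<phi> (X \<omega>)"
    proof (rule ccontr)
      assume "\<not> ereal (g \<omega>) \<le> \<phi> (X \<omega>)"
      \<comment> \<open>A rational strictly between the two values would itself be a term of the
        supremum.\<close>
      then obtain q where q: "\<phi> (X \<omega>) < real_of_rat q" "ereal (real_of_rat q) < g \<omega>"
        using ereal_dense3[of "\<phi> (X \<omega>)" "ereal (g \<omega>)"] by (auto simp: not_le)
      then have "ereal (real_of_rat q) \<le> \<phi> (X \<omega>)"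
        unfolding \<phi>_def by (intro SUP_upper2[of q]) (simp_all add: B_iff)
      with q show False by simp
    qed
  qed
  \<comment> \<open>Infinite values become 0, which is harmless because they cannot occur on the
    image of \<open>X\<close>.\<close>
  moreover have "(\<lambda>x. real_of_ereal (\<phi> x)) \<in> borel_measurable N"
    unfolding \<phi>_def by measurable
  ultimately show thesis
    by (intro that[of "\<lambda>x. real_of_ereal (\<phi> x)"]) simp_all
qed

section \<open>Conditional expectation in real coordinates\<close>

lemma cond_exp_inner_Basis:
  "b \<in> Basis \<Longrightarrow> cond_exp M G F x \<bullet> b = real_cond_exp M G (\<lambda>y. F y \<bullet> b) x"
  by (simp add: cond_exp_def)

lemma borel_measurable_cond_exp_subalgebra:
  "cond_exp M G F \<in> borel_measurable G"
  unfolding cond_exp_def by measurable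

lemma L2_fun_integrable_Basis_mult:
  assumes f: "f \<in> L2_fun M" and g: "g \<in> L2_fun M" and "i \<in> Basis" "j \<in> Basis"
  shows "integrable M (\<lambda>x. (f x \<bullet> i) * (g x \<bullet> j))"
proof (rule L2_fun_integrable_prod[OF f g, where h = "\<lambda>a b. (a \<bullet> i) * (b \<bullet> j)"])
  note [measurable] = L2_fun_measurable[OF f] L2_fun_measurable[OF g]
  show "(\<lambda>x. (f x \<bullet> i) * (g x \<bullet> j)) \<in> borel_measurable M" by measurable
  show "norm ((a \<bullet> i) * (b \<bullet> j)) \<le> norm a * norm b" for a b
    using assms(3,4) by (simp add: abs_mult mult_mono Basis_le_norm)
qed

text \<open>Reduces an integral of \<open>h (f x) (g x)\<close> to integrals of products of real
  coordinates, to which the real pull-out property applies.\<close>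

lemma bounded_bilinear_euclidean_expand:
  fixes h :: "'a::euclidean_space \<Rightarrow> 'b::euclidean_space \<Rightarrow> 'c::real_normed_vector"
  assumes "bounded_bilinear h"
  shows "h a b = (\<Sum>i\<in>Basis. \<Sum>j\<in>Basis. ((a \<bullet> i) * (b \<bullet> j)) *\<^sub>R h i j)"
proof -
  interpret bounded_bilinear h by fact
  have "h a b = h (\<Sum>i\<in>Basis. (a \<bullet> i) *\<^sub>R i) (\<Sum>j\<in>Basis. (b \<bullet> j) *\<^sub>R j)"
    by (simp add: euclidean_representation)
  also have "\<dots> = (\<Sum>i\<in>Basis. \<Sum>j\<in>Basis. ((a \<bullet> i) * (b \<bullet> j)) *\<^sub>R h i j)"
    by (simp add: sum_left sum_right scaleR_left scaleR_right scaleR_sum_right)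
      (subst sum.swap, simp add: mult.commute)
  finally show ?thesis .
qed

context finite_measure_subalgebra
begin

text \<open>Conditional Jensen for the square function in each coordinate; the squared norm is the
  sum of the squared coordinates.\<close>

lemma cond_exp_in_L2_fun:
  assumes f: "f \<in> L2_fun M"
  shows "cond_exp M F f \<in> L2_fun M"
proof (rule L2_funI)
  show "cond_exp M F f \<in> borel_measurable M"
    using borel_measurable_cond_exp_subalgebra by (rule measurable_from_subalg[OF subalg])
  note [measurable] = L2_fun_measurable[OF f]
  have "integrable M (\<lambda>x. (real_cond_exp M F (\<lambda>y. f y \<bullet> b) x)\<^sup>2)" if b: "b \<in> Basis" for b
  proof (rule integrable_convex_cond_exp[where I = UNIV])
    show sq: "integrable M (\<lambda>x. (f x \<bullet> b)\<^sup>2)"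
      unfolding power2_eq_square by (rule L2_fun_integrable_Basis_mult[OF f f b b])
    show "integrable M (\<lambda>x. f x \<bullet> b)"
      \<comment> \<open>Finiteness of the measure enters here.\<close>
      by (rule square_integrable_imp_integrable[OF _ sq]) measurable
  qed (simp_all add: convex_power2)
  then show "integrable M (\<lambda>x. (norm (cond_exp M F f x))\<^sup>2)"
    unfolding power2_norm_eq_inner
    by (subst euclidean_inner) (simp add: cond_exp_inner_Basis flip: power2_eq_square)
qed

lemma integral_bilinear_cond_exp:
  fixes h :: "'k::{real_normed_field, euclidean_space} \<Rightarrow> 'k \<Rightarrow> 'c::{banach, second_countable_topology}"
  assumes h: "bounded_bilinear h"
    and f: "f \<in> L2_fun M" "f \<in> borel_measurable F" and g: "g \<in> L2_fun M"
  shows "(\<integral>x. h (f x) (cond_exp M F g x) \<partial>M) = (\<integral>x. h (f x) (g x) \<partial>M)"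
proof -
  note [measurable] = f(2) L2_fun_measurable[OF f(1)] L2_fun_measurable[OF g]
  note int = L2_fun_integrable_Basis_mult[OF f(1) g]
  have "integrable M (\<lambda>x. (f x \<bullet> i) * (cond_exp M F g x \<bullet> j))"
    "(\<integral>x. (f x \<bullet> i) * (cond_exp M F g x \<bullet> j) \<partial>M) = (\<integral>x. (f x \<bullet> i) * (g x \<bullet> j) \<partial>M)"
    if "i \<in> Basis" "j \<in> Basis" for i j
    using real_cond_exp_intg[OF int[OF that]] that by (simp_all add: cond_exp_inner_Basis)
  then show ?thesis
    unfolding bounded_bilinear_euclidean_expand[OF h, of "f _"] by (simp add: int)
qed

end


section \<open>Composition with X\<close>

lemma subalgebra_pullback_algebra:
  assumes "X \<in> borel_measurable M"
  shows "subalgebra M (pullback_algebra M X)"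
  using sets_image_in_sets[OF refl assms] by (simp add: subalgebra_def pullback_algebra_def)

lemma measurable_pullback_algebra:
  "X \<in> borel_measurable (pullback_algebra M X)"
  by (simp add: pullback_algebra_def measurable_vimage_algebra1)

lemma L2_fun_distr_iff:
  assumes [measurable]: "X \<in> borel_measurable M" "\<phi> \<in> borel_measurable borel"
  shows "\<phi> \<in> L2_fun (distr M borel X) \<longleftrightarrow> \<phi> \<circ> X \<in> L2_fun M"
  by (simp add: L2_fun_def integrable_distr_eq comp_def)

lemma L2_fun_distr_comp:
  assumes "X \<in> borel_measurable M" "\<phi> \<in> L2_fun (distr M borel X)"
  shows "\<phi> \<circ> X \<in> L2_fun M"
  using assms L2_fun_distr_iff[OF assms(1), of \<phi>] L2_fun_measurable[OF assms(2)] by simp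

lemma l2_norm_comp:
  assumes X [measurable]: "X \<in> borel_measurable M" and \<phi>: "\<phi> \<in> L2_fun (distr M borel X)"
  shows "l2_norm M (l2_class M (\<phi> \<circ> X)) = l2_norm (distr M borel X) (l2_class (distr M borel X) \<phi>)"
proof -
  have [measurable]: "\<phi> \<in> borel_measurable borel"
    using L2_fun_measurable[OF \<phi>] by simp
  show ?thesis
    using \<phi> L2_fun_distr_comp[OF X \<phi>] by (simp add: l2_norm_class integral_distr)
qed

text \<open>Null sets of the distribution pull back under \<open>X\<close> to null sets of
  \<open>M\<close>, so composition respects almost everywhere equality.\<close>

lemma comp_op_class:
  assumes X [measurable]: "X \<in> borel_measurable M" and \<phi>: "\<phi> \<in> L2_fun (distr M borel X)"
  shows "comp_op M X (l2_class (distr M borel X) \<phi>) = l2_class M (\<phi> \<circ> X)"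
proof -
  let ?\<psi> = "l2_rep (l2_class (distr M borel X) \<phi>)"
  have "AE \<omega> in M. ?\<psi> (X \<omega>) = \<phi> (X \<omega>)"
    using AE_distrD[OF X AE_l2_rep_class[OF \<phi>]] .
  then have "l2_class M (?\<psi> \<circ> X) = l2_class M (\<phi> \<circ> X)"
    using \<phi> by (subst l2_class_eq_iff) (auto intro!: L2_fun_distr_comp l2_rep_class_in_L2_fun)
  then show ?thesis
    using l2_class_in_L2[OF \<phi>] by (simp add: comp_op_def)
qed

lemma l2_isometric_comp_op:
  fixes X :: "'a \<Rightarrow> real"
  assumes X: "X \<in> borel_measurable M"
  shows "l2_isometric (distr M borel X) M
    (comp_op M X :: (real \<Rightarrow> 'k::{real_normed_field, euclidean_space}) set \<Rightarrow> _)"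
proof -
  let ?\<mu> = "distr M borel X"
  let ?T = "comp_op M X :: (real \<Rightarrow> 'k) set \<Rightarrow> _"
  have "?T a \<in> L2 M" if "a \<in> L2 ?\<mu>" for a
    using that by (elim L2_cases) (simp add: X comp_op_class L2_fun_distr_comp l2_class_in_L2)
  moreover have "?T (l2_add ?\<mu> a b) = l2_add M (?T a) (?T b)" if "a \<in> L2 ?\<mu>" "b \<in> L2 ?\<mu>" for a b
    using that
    by (elim L2_cases)
      (simp add: X comp_op_class l2_add_class L2_fun_add L2_fun_distr_comp, simp add: comp_def)
  moreover have "?T (l2_scale ?\<mu> c a) = l2_scale M c (?T a)" if "a \<in> L2 ?\<mu>" for a c
    using that
    by (elim L2_cases)
      (simp add: X comp_op_class l2_scale_class L2_fun_mult_left L2_fun_distr_comp, simp add: comp_def)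
  moreover have iso: "l2_norm M (?T a) = l2_norm ?\<mu> a" if "a \<in> L2 ?\<mu>" for a
    using that by (elim L2_cases) (simp add: X comp_op_class l2_norm_comp)
  moreover have "l2_norm M (?T a) \<le> 1 * l2_norm ?\<mu> a" if "a \<in> L2 ?\<mu>" for a
    using iso[OF that] by simp
  ultimately show ?thesis
    unfolding l2_isometric_def l2_operator_def by blast
qed

section \<open>Conditional expectation as a function of the value of X\<close>

text \<open>Each real coordinate is measurable for the pullback algebra and factors through
  \<open>X\<close>; the factors are reassembled along the basis.\<close>

lemma cond_exp_at_exists:
  fixes F :: "'a \<Rightarrow> 'k::euclidean_space"
  shows "\<exists>\<phi>. cond_exp_at M X F \<phi>"
proof -
  have "\<exists>\<phi>. \<phi> \<in> borel_measurable borel \<and>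
      (\<forall>\<omega>\<in>space M. real_cond_exp M (pullback_algebra M X) (\<lambda>y. F y \<bullet> b) \<omega> = \<phi> (X \<omega>))" for b
    by (rule real_measurable_vimage_algebra_factor[of
          "real_cond_exp M (pullback_algebra M X) (\<lambda>y. F y \<bullet> b)" "space M" X borel])
      (auto simp flip: pullback_algebra_def)
  then obtain \<phi> where [measurable]: "\<And>b. \<phi> b \<in> borel_measurable borel"
    and \<phi>: "\<And>b \<omega>. \<omega> \<in> space M \<Longrightarrow>
      real_cond_exp M (pullback_algebra M X) (\<lambda>y. F y \<bullet> b) \<omega> = \<phi> b (X \<omega>)"
    by metis
  have "cond_exp_at M X F (\<lambda>x. \<Sum>b\<in>Basis. \<phi> b x *\<^sub>R b)"
    unfolding cond_exp_at_def cond_exp_def by (auto intro!: AE_I2 simp: \<phi>)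
  then show ?thesis by blast
qed

lemma (in prob_space) cond_exp_at_in_L2_fun:
  assumes X [measurable]: "X \<in> borel_measurable M" and F: "F \<in> L2_fun M"
    and \<phi>: "cond_exp_at M X F \<phi>"
  shows "\<phi> \<in> L2_fun (distr M borel X)"
proof -
  interpret finite_measure_subalgebra M "pullback_algebra M X"
    by unfold_locales (rule subalgebra_pullback_algebra[OF X])
  let ?E = "cond_exp M (pullback_algebra M X) F"
  have [measurable]: "\<phi> \<in> borel_measurable borel" and AE: "AE \<omega> in M. ?E \<omega> = (\<phi> \<circ> X) \<omega>"
    using \<phi> by (simp_all add: cond_exp_at_def)
  note E = cond_exp_in_L2_fun[OF F]
  note [measurable] = L2_fun_measurable[OF E]
  have "integrable M (\<lambda>\<omega>. (norm ((\<phi> \<circ> X) \<omega>))\<^sup>2)"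
    using AE by (intro integrable_cong_AE_imp[OF L2_fun_integrable[OF E]]) auto
  then have "\<phi> \<circ> X \<in> L2_fun M"
    by (intro L2_funI) measurable
  then show ?thesis
    by (simp add: L2_fun_distr_iff)
qed

text \<open>The adjoint relation at the level of functions, valid for every version
  \<open>\<phi>\<close> of the conditional expectation.\<close>

lemma (in prob_space) l2_inner_comp_cond_exp_at:
  assumes X [measurable]: "X \<in> borel_measurable M" and F: "F \<in> L2_fun M"
    and \<phi>: "cond_exp_at M X F \<phi>" and \<psi>: "\<psi> \<in> L2_fun (distr M borel X)"
  shows "l2_inner M (l2_class M (\<psi> \<circ> X)) (l2_class M F) =
    l2_inner (distr M borel X) (l2_class (distr M borel X) \<psi>) (l2_class (distr M borel X) \<phi>)"
proof -
  interpret finite_measure_subalgebra M "pullback_algebra M X"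
    by unfold_locales (rule subalgebra_pullback_algebra[OF X])
  let ?E = "cond_exp M (pullback_algebra M X) F"
  have [measurable]: "\<phi> \<in> borel_measurable borel" and AE: "AE \<omega> in M. ?E \<omega> = (\<phi> \<circ> X) \<omega>"
    using \<phi> by (simp_all add: cond_exp_at_def)
  have \<psi>_meas [measurable]: "\<psi> \<in> borel_measurable borel"
    using L2_fun_measurable[OF \<psi>] by simp
  note [measurable] = L2_fun_measurable[OF cond_exp_in_L2_fun[OF F]]
  note \<psi>X = L2_fun_distr_comp[OF X \<psi>]
  have bilin: "bounded_bilinear (\<lambda>a b. a * sconj b)"
    by (rule bounded_bilinear.comp[OF bounded_bilinear_mult bounded_linear_ident bounded_linear_sconj])
  have "l2_inner M (l2_class M (\<psi> \<circ> X)) (l2_class M F) = (\<integral>\<omega>. (\<psi> \<circ> X) \<omega> * sconj (F \<omega>) \<partial>M)"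
    by (rule l2_inner_class[OF \<psi>X F])
  \<comment> \<open>Pull-out: \<open>\<psi> \<circ> X\<close> is measurable for the pullback
    algebra.\<close>
  also have "\<dots> = (\<integral>\<omega>. (\<psi> \<circ> X) \<omega> * sconj (?E \<omega>) \<partial>M)"
    using measurable_comp[OF measurable_pullback_algebra \<psi>_meas]
    by (intro integral_bilinear_cond_exp[OF bilin \<psi>X _ F, symmetric])
  also have "\<dots> = (\<integral>\<omega>. \<psi> (X \<omega>) * sconj (\<phi> (X \<omega>)) \<partial>M)"
    using AE by (intro integral_cong_AE) auto
  also have "\<dots> = (\<integral>x. \<psi> x * sconj (\<phi> x) \<partial>distr M borel X)"
    by (simp add: integral_distr)
  also have "\<dots> = l2_inner (distr M borel X) (l2_class (distr M borel X) \<psi>) (l2_class (distr M borel X) \<phi>)"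
    by (rule l2_inner_class[OF \<psi> cond_exp_at_in_L2_fun[OF X F \<phi>], symmetric])
  finally show ?thesis .
qed

theorem proposition1p3:
  fixes M :: "'a measure" and X :: "'a \<Rightarrow> real" and \<mu> :: "real measure"
    and T :: "(real \<Rightarrow> 'k::{real_normed_field, euclidean_space}) set \<Rightarrow> ('a \<Rightarrow> 'k) set"
    and T_adj :: "('a \<Rightarrow> 'k) set \<Rightarrow> (real \<Rightarrow> 'k) set"
  assumes "prob_space M"
    and "X \<in> borel_measurable M"
    and "\<mu> = distr M borel X"
    and "T = comp_op M X"
    and "T_adj = l2_adjoint \<mu> M T"
  shows "(\<forall>\<phi>\<in>L2_fun \<mu>. T (l2_class \<mu> \<phi>) = l2_class M (\<phi> \<circ> X)) \<and>
    l2_isometric \<mu> M T \<and>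
    is_l2_adjoint \<mu> M T T_adj \<and>
    l2_coisometric M \<mu> T_adj \<and>
    (\<forall>F\<in>L2_fun M.
       (\<exists>\<phi>. cond_exp_at M X F \<phi>) \<and>
       (\<forall>\<phi>. cond_exp_at M X F \<phi> \<longrightarrow>
          \<phi> \<in> L2_fun \<mu> \<and> T_adj (l2_class M F) = l2_class \<mu> \<phi>))"
proof -
  interpret prob_space M by fact
  note X = assms(2)
  have T_class: "T (l2_class \<mu> \<phi>) = l2_class M (\<phi> \<circ> X)" if "\<phi> \<in> L2_fun \<mu>" for \<phi>
    using comp_op_class[OF X] that by (simp add: assms(3,4))
  have T_iso: "l2_isometric \<mu> M T"
    unfolding assms(3,4) by (rule l2_isometric_comp_op[OF X])
  then have T_op: "l2_operator \<mu> M T" and T_L2: "\<And>a. a \<in> L2 \<mu> \<Longrightarrow> T a \<in> L2 M"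
    by (simp_all add: l2_isometric_def) (simp add: l2_operator_def)
  \<comment> \<open>An arbitrary version is chosen for an arbitrary representative; independence of
    both choices is shown at the end. The restriction to \<open>L2 M\<close> supplies the
    extensionality that \<open>l2_adjoint_eqI\<close> asks for.\<close>
  define S :: "('a \<Rightarrow> 'k) set \<Rightarrow> (real \<Rightarrow> 'k) set" where
    "S = (\<lambda>b\<in>L2 M. l2_class \<mu> (SOME \<phi>. cond_exp_at M X (l2_rep b) \<phi>))"
  have S: "\<exists>\<phi>. cond_exp_at M X (l2_rep b) \<phi> \<and> S b = l2_class \<mu> \<phi>" if "b \<in> L2 M" for b
    using that someI_ex[OF cond_exp_at_exists[of M X "l2_rep b"]] by (auto simp: S_def)
  \<comment> \<open>Stated for any \<open>F\<close> and \<open>\<phi>\<close>, so that it serves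
    both the choices inside \<open>S\<close> and the arbitrary versions in the final claim.\<close>
  have adj: "l2_inner M (T a) b = l2_inner \<mu> a (l2_class \<mu> \<phi>)"
    if "a \<in> L2 \<mu>" "F \<in> L2_fun M" "b = l2_class M F" "cond_exp_at M X F \<phi>" for a b F \<phi>
    using that l2_inner_comp_cond_exp_at[OF X that(2,4)]
    by (elim L2_cases) (simp add: T_class, simp add: assms(3))
  have S_L2: "S b \<in> L2 \<mu>" if "b \<in> L2 M" for b
    using S[OF that] cond_exp_at_in_L2_fun[OF X l2_rep_in_L2_fun[OF that]]
    by (metis assms(3) l2_class_in_L2)
  have S_adj: "l2_inner M (T a) b = l2_inner \<mu> a (S b)" if "a \<in> L2 \<mu>" "b \<in> L2 M" for a b
    using S[OF that(2)] adj[OF that(1) l2_rep_in_L2_fun[OF that(2)] l2_class_rep[OF that(2), symmetric]]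
    by auto
  have S_is_adj: "is_l2_adjoint \<mu> M T S"
    using T_iso S_L2 S_adj by (rule is_l2_adjointI)
  have T_adj: "T_adj = S"
    unfolding assms(5) by (rule l2_adjoint_eqI[OF _ S_is_adj]) (simp add: S_def)
  \<comment> \<open>Conjugate symmetry reverses the adjoint relation, making \<open>T\<close> the
    adjoint of \<open>S\<close>; coisometry of \<open>S\<close> is then isometry of
    \<open>T\<close>.\<close>
  have "l2_inner \<mu> (S b) a = l2_inner M b (T a)" if "a \<in> L2 \<mu>" "b \<in> L2 M" for a b
    using that by (metis S_L2 S_adj T_L2 l2_inner_commute)
  then have "is_l2_adjoint M \<mu> S T"
    using T_op by (simp add: is_l2_adjoint_def)
  then have "l2_adjoint M \<mu> S = T"
    by (rule l2_adjoint_eqI[rotated]) (simp add: assms(3,4) comp_op_def)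
  then have coiso: "l2_coisometric M \<mu> S"
    using T_iso S_is_adj by (simp add: l2_coisometric_def is_l2_adjoint_def)
  \<comment> \<open>By nondegeneracy: both classes have inner product
    \<open>l2_inner M (T a) (l2_class M F)\<close> with every \<open>a\<close>.\<close>
  have "S (l2_class M F) = l2_class \<mu> \<phi>" if F: "F \<in> L2_fun M" and \<phi>: "cond_exp_at M X F \<phi>" for F \<phi>
  proof (rule l2_eqI)
    show "l2_class \<mu> \<phi> \<in> L2 \<mu>"
      using cond_exp_at_in_L2_fun[OF X F \<phi>] by (simp add: assms(3) l2_class_in_L2)
    show "l2_inner \<mu> a (S (l2_class M F)) = l2_inner \<mu> a (l2_class \<mu> \<phi>)" if "a \<in> L2 \<mu>" for a
      using S_adj[OF that l2_class_in_L2[OF F]] adj[OF that F refl \<phi>] by simp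
  qed (rule S_L2[OF l2_class_in_L2[OF F]])
  then show ?thesis
    using T_class T_iso S_is_adj coiso cond_exp_at_exists cond_exp_at_in_L2_fun[OF X]
    by (auto simp: T_adj assms(3))
qed

end
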